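(* Let $k,m\geq 3$ be integers. Then every variety in the interval $[\mathsf{V}(S_c(a_1\cdots a_k)),\mathcal{W}_{k,m}]$ is nonfinitely based.
   Context: An ai-semiring is an algebra $(S,+,\cdot)$ with two binary operations (no constants in the signature) such that $(S,+)$ is a commutative idempotent semigroup, $(S,\cdot)$ is a semigroup, and $x(y+z)\approx xy+xz$, $(x+y)z\approx xz+yz$ hold. $\mathsf{V}(S)$ is the variety of ai-semirings generated by $S$. For ai-semiring varieties $\mathcal{A}\subseteq\mathcal{B}$, $[\mathcal{A},\mathcal{B}]$ is the class of all varieties $\mathcal{C}$ with $\mathcal{A}\subseteq\mathcal{C}\subseteq\mathcal{B}$. A variety is finitely based if it can be defined by a finite set of identities, and nonfinitely based otherwise. $S_c(a_1\cdots a_k)$, for distinct letters $a_1,\dots,a_k$: its elements are all nonempty subwords of the commutative word $a_1\cdots a_k$ (i.e. the products $\prod_{i\in A}a_i$, $\emptyset\neq A\subseteq\{1,\dots,k\}$, in the free commutative semigroup) together with a symbol $0$. The product of two words is their product in the free commutative semigroup if this is again a subword of $a_1\cdots a_k$, and $0$ otherwise; $0$ is the multiplicative zero; $x+x=x$ and $x+y=0$ for $x\neq y$. Hypergraphs: a hypergraph is a pair $(V,E)$ with $E$ a family of nonempty subsets (hyperedges) of $V$; it is $k$-uniform if every hyperedge has $k$ elements. A cycle of length $n\geq 2$ is an alternating sequence $v_0,e_1,v_1,\dots,e_n,v_n$ with $v_0=v_n$, $v_0,\dots,v_{n-1}$ distinct vertices, $e_1,\dots,e_n$ distinct hyperedges,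 and $\{v_{i-1},v_i\}\subseteq e_i$ for $1\leq i\leq n$. The girth is the length of a shortest cycle ($\infty$ if there is none). A hypergraph is $m$-colourable if there is a map $\varphi:V\to\{1,\dots,m\}$ with $|\varphi(e)|\geq 2$ for all $e\in E$ with $|e|\geq 2$. For all integers $k,m,n\geq 3$, $\mathbb{H}_n=\mathbb{H}_n^{(k,m)}=(V_n,E_n)$ is a fixed finite $k$-uniform hypergraph without isolated vertices that has girth greater than $k\binom{kn}{2}$ and is not $m$-colourable (such hypergraphs exist by Erdős–Hajnal). For a finite $k$-uniform hypergraph $\mathbb{H}=(V,E)$, with a variable $x_v$ for each $v\in V$, $\mathbf{t}_{\mathbb{H}}$ is the ai-semiring term that is the sum of all words $x_{v_1}\cdots x_{v_k}$ with $\{v_1,\dots,v_k\}\in E$ (all $k!$ orderings of each hyperedge), and $\mathbf{q}_{\mathbb{H}}$ is the word $\prod_{v\in V}x_v$ (in any fixed order). $\mathcal{W}_{k,m}$ is the ai-semiring variety defined by the identities $\mathbf{t}_{\mathbb{H}_n}\approx\mathbf{t}_{\mathbb{H}_n}+\mathbf{q}_{\mathbb{H}_n}$ for all $n\geq 3$. It contains $S_c(a_1\cdots a_k)$. *)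

theory Defs
  imports "HOL-Library.Multiset" "HOL-Library.FuncSet" "HOL-Library.Extended_Nat"
begin

record 'a ai_alg =
  carrier :: "'a set"
  add :: "'a \<Rightarrow> 'a \<Rightarrow> 'a"  (infixl "\<oplus>\<index>" 65)
  mul :: "'a \<Rightarrow> 'a \<Rightarrow> 'a"  (infixl "\<otimes>\<index>" 70)

locale ai_semiring =
  fixes S :: "'a ai_alg" (structure)
  assumes carrier_nonempty: "carrier S \<noteq> {}"
    and add_closed: "\<lbrakk>x \<in> carrier S; y \<in> carrier S\<rbrakk> \<Longrightarrow> x \<oplus> y \<in> carrier S"
    and mul_closed: "\<lbrakk>x \<in> carrier S; y \<in> carrier S\<rbrakk> \<Longrightarrow> x \<otimes> y \<in> carrier S"
    and add_assoc: "\<lbrakk>x \<in> carrier S; y \<in> carrier S; z \<in> carrier S\<rbrakk>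
      \<Longrightarrow> (x \<oplus> y) \<oplus> z = x \<oplus> (y \<oplus> z)"
    and add_comm: "\<lbrakk>x \<in> carrier S; y \<in> carrier S\<rbrakk> \<Longrightarrow> x \<oplus> y = y \<oplus> x"
    and add_idem: "x \<in> carrier S \<Longrightarrow> x \<oplus> x = x"
    and mul_assoc: "\<lbrakk>x \<in> carrier S; y \<in> carrier S; z \<in> carrier S\<rbrakk>
      \<Longrightarrow> (x \<otimes> y) \<otimes> z = x \<otimes> (y \<otimes> z)"
    and distrib_left: "\<lbrakk>x \<in> carrier S; y \<in> carrier S; z \<in> carrier S\<rbrakk>
      \<Longrightarrow> x \<otimes> (y \<oplus> z) = (x \<otimes> y) \<oplus> (x \<otimes> z)"
    and distrib_right: "\<lbrakk>x \<in> carrier S; y \<in> carrier S; z \<in> carrier S\<rbrakk>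
      \<Longrightarrow> (x \<oplus> y) \<otimes> z = (x \<otimes> z) \<oplus> (y \<otimes> z)"

definition ai_hom :: "'a ai_alg \<Rightarrow> 'b ai_alg \<Rightarrow> ('a \<Rightarrow> 'b) set" where
  "ai_hom A B = {h. h \<in> carrier A \<rightarrow> carrier B \<and>
     (\<forall>x\<in>carrier A. \<forall>y\<in>carrier A.
        h (x \<oplus>\<^bsub>A\<^esub> y) = h x \<oplus>\<^bsub>B\<^esub> h y \<and> h (x \<otimes>\<^bsub>A\<^esub> y) = h x \<otimes>\<^bsub>B\<^esub> h y)}"

definition ai_iso :: "'a ai_alg \<Rightarrow> 'b ai_alg \<Rightarrow> bool" where
  "ai_iso A B \<longleftrightarrow> (\<exists>h\<in>ai_hom A B. bij_betw h (carrier A) (carrier B))"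

definition direct_product :: "'i set \<Rightarrow> ('i \<Rightarrow> 'a ai_alg) \<Rightarrow> ('i \<Rightarrow> 'a) ai_alg" where
  "direct_product I A =
     \<lparr>carrier = (\<Pi>\<^sub>E i\<in>I. carrier (A i)),
      add = (\<lambda>f g. \<lambda>i\<in>I. f i \<oplus>\<^bsub>A i\<^esub> g i),
      mul = (\<lambda>f g. \<lambda>i\<in>I. f i \<otimes>\<^bsub>A i\<^esub> g i)\<rparr>"

datatype 'x ai_term = Var 'x | Plus "'x ai_term" "'x ai_term" | Times "'x ai_term" "'x ai_term"

primrec eval :: "'a ai_alg \<Rightarrow> ('x \<Rightarrow> 'a) \<Rightarrow> 'x ai_term \<Rightarrow> 'a" where
  "eval A \<sigma> (Var x) = \<sigma> x"
| "eval A \<sigma> (Plus s t) = eval A \<sigma> s \<oplus>\<^bsub>A\<^esub> eval A \<sigma> t"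
| "eval A \<sigma> (Times s t) = eval A \<sigma> s \<otimes>\<^bsub>A\<^esub> eval A \<sigma> t"

type_synonym 'x identity = "'x ai_term \<times> 'x ai_term"

definition satisfies :: "'a ai_alg \<Rightarrow> 'x identity \<Rightarrow> bool" where
  "satisfies A e \<longleftrightarrow> (\<forall>\<sigma>. range \<sigma> \<subseteq> carrier A \<longrightarrow> eval A \<sigma> (fst e) = eval A \<sigma> (snd e))"

definition models :: "'x identity set \<Rightarrow> 'a ai_alg set" where
  "models \<Sigma> = {A. ai_semiring A \<and> (\<forall>e\<in>\<Sigma>. satisfies A e)}"

text \<open>
  A variety is represented by its members whose carriers are subsets of a type \<open>'a\<close>. If \<open>'a\<close>
  is infinite, this loses nothing: a variety is determined by its countable members. Since a direct
  product of members may be too large for \<open>'a\<close>, closure under subalgebras and closure under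
  direct products are stated together, as closure under algebras that embed into a direct product
  of members; one-element index sets give the subalgebras, the empty index set gives the trivial
  algebra. An algebra over \<open>'a\<close> that embeds into the product of any family embeds into a product
  indexed by pairs of its elements (for each pair of distinct elements pick one factor that
  separates them), so \<open>'a \<times> 'a\<close> suffices as index type.
\<close>

definition variety :: "'a ai_alg set \<Rightarrow> bool" where
  "variety \<C> \<longleftrightarrow>
     (\<forall>A\<in>\<C>. ai_semiring A) \<and>
     (\<forall>A\<in>\<C>. \<forall>B h. ai_semiring B \<and> h \<in> ai_hom A B \<and> h ` carrier A = carrier B \<longrightarrow> B \<in> \<C>) \<and>
     (\<forall>(I :: ('a \<times> 'a) set) A B h. (\<forall>i\<in>I. A i \<in> \<C>) \<and> ai_semiring B \<and>
        h \<in> ai_hom B (direct_product I A) \<and> inj_on h (carrier B) \<longrightarrow> B \<in> \<C>)"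

text \<open>
  The least variety containing \<open>S\<close>. The carrier type of \<open>S\<close> need not be \<open>'a\<close>, so membership
  of \<open>S\<close> is up to isomorphism.
\<close>

definition generated_variety :: "'b ai_alg \<Rightarrow> 'a ai_alg set" where
  "generated_variety S = \<Inter>{\<C>. variety \<C> \<and> (\<exists>T\<in>\<C>. ai_iso S T)}"

definition variety_interval :: "'a ai_alg set \<Rightarrow> 'a ai_alg set \<Rightarrow> 'a ai_alg set set" where
  "variety_interval \<A> \<B> = {\<C>. variety \<C> \<and> \<A> \<subseteq> \<C> \<and> \<C> \<subseteq> \<B>}"

definition finitely_based :: "'a ai_alg set \<Rightarrow> bool" where
  "finitely_based \<C> \<longleftrightarrow> (\<exists>\<Sigma> :: nat identity set. finite \<Sigma> \<and> \<C> = models \<Sigma>)"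

text \<open>
  The letter \<open>a\<^sub>i\<close> is the number \<open>i\<close>, the free commutative semigroup consists of the nonempty
  multisets of letters, and the symbol \<open>0\<close> is \<^const>\<open>None\<close>.
\<close>

definition S_c :: "nat \<Rightarrow> nat multiset option ai_alg" where
  "S_c k =
     \<lparr>carrier = insert None (Some ` {u. u \<noteq> {#} \<and> u \<subseteq># mset_set {1..k}}),
      add = (\<lambda>x y. if x = y then x else None),
      mul = (\<lambda>x y. case (x, y) of
               (Some u, Some v) \<Rightarrow> if u + v \<subseteq># mset_set {1..k} then Some (u + v) else None
             | _ \<Rightarrow> None)\<rparr>"

record 'v hypergraph =
  verts :: "'v set"
  hyperedges :: "'v set set"

definition finite_hypergraph :: "'v hypergraph \<Rightarrow> bool" where
  "finite_hypergraph H \<longleftrightarrow>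
     finite (verts H) \<and> (\<forall>e\<in>hyperedges H. e \<noteq> {} \<and> e \<subseteq> verts H)"

definition uniform :: "nat \<Rightarrow> 'v hypergraph \<Rightarrow> bool" where
  "uniform k H \<longleftrightarrow> (\<forall>e\<in>hyperedges H. card e = k)"

definition no_isolated_vertices :: "'v hypergraph \<Rightarrow> bool" where
  "no_isolated_vertices H \<longleftrightarrow> (\<forall>v\<in>verts H. \<exists>e\<in>hyperedges H. v \<in> e)"

definition is_cycle :: "'v hypergraph \<Rightarrow> nat \<Rightarrow> (nat \<Rightarrow> 'v) \<Rightarrow> (nat \<Rightarrow> 'v set) \<Rightarrow> bool" where
  "is_cycle H n v e \<longleftrightarrow> n \<ge> 2 \<and> v 0 = v n \<and>
     inj_on v {0..<n} \<and> v ` {0..<n} \<subseteq> verts H \<and>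
     inj_on e {1..n} \<and> e ` {1..n} \<subseteq> hyperedges H \<and>
     (\<forall>i\<in>{1..n}. {v (i - 1), v i} \<subseteq> e i)"

text \<open>The infimum of the empty set in \<^typ>\<open>enat\<close> is \<open>\<infinity>\<close>.\<close>

definition girth :: "'v hypergraph \<Rightarrow> enat" where
  "girth H = Inf {enat n | n. \<exists>v e. is_cycle H n v e}"

definition colourable :: "nat \<Rightarrow> 'v hypergraph \<Rightarrow> bool" where
  "colourable m H \<longleftrightarrow> (\<exists>\<phi> :: 'v \<Rightarrow> nat. \<phi> ` verts H \<subseteq> {1..m} \<and>
     (\<forall>e\<in>hyperedges H. card e \<ge> 2 \<longrightarrow> card (\<phi> ` e) \<ge> 2))"

text \<open>Combines the entries of a nonempty list; the value on the empty list is irrelevant.\<close>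

fun fold1 :: "('b \<Rightarrow> 'b \<Rightarrow> 'b) \<Rightarrow> 'b list \<Rightarrow> 'b" where
  "fold1 f [] = undefined"
| "fold1 f [x] = x"
| "fold1 f (x # y # ys) = f x (fold1 f (y # ys))"

definition word :: "'x list \<Rightarrow> 'x ai_term" where
  "word xs = fold1 Times (map Var xs)"

text \<open>
  The summation order is an arbitrary choice, immaterial in ai-semirings.
\<close>

definition sum_of_words :: "'x list set \<Rightarrow> 'x ai_term" where
  "sum_of_words X = fold1 Plus (map word (SOME xss. distinct xss \<and> set xss = X))"

definition t_term :: "'v hypergraph \<Rightarrow> 'v ai_term" where
  "t_term H = sum_of_words {vs. distinct vs \<and> set vs \<in> hyperedges H}"

text \<open>
  For \<open>n \<ge> 3\<close>, \<open>H n\<close> is the hypergraph \<open>\<bbbH>\<^sub>n\<close>, and \<open>vs n\<close> lists its vertices in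
  the order in which they occur in the word \<open>\<^bold>q\<close>. (Multiplication need not be commutative, so this
  order is kept as a parameter.)
\<close>

definition W_identities :: "(nat \<Rightarrow> 'v hypergraph) \<Rightarrow> (nat \<Rightarrow> 'v list) \<Rightarrow> 'v identity set" where
  "W_identities H vs = {(t_term (H n), Plus (t_term (H n)) (word (vs n))) | n. n \<ge> 3}"

definition W :: "(nat \<Rightarrow> 'v hypergraph) \<Rightarrow> (nat \<Rightarrow> 'v list) \<Rightarrow> 'a ai_alg set" where
  "W H vs = models (W_identities H vs)"

end

theory Submission
  imports Defs "HOL-Library.Set_Algebras" "HOL-Combinatorics.Permutations"
begin

text \<open>
  Suppose that a variety \<open>\<C>\<close> in the interval is defined by a finite set \<open>\<Sigma>\<close> of identities. They
  all hold in \<open>S\<^sub>c(a\<^sub>1\<cdots>a\<^sub>k)\<close>. For large \<open>n\<close>, a finite ai-semiring is built that still satisfies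
  \<open>\<Sigma>\<close>, so that it is in \<open>\<C>\<close>, but violates the identity of \<open>\<bbbH>\<^sub>n\<close>, so that it is not in
  \<open>\<W>\<^bsub>k,m\<^esub>\<close>.

  This is the residual (or syntactic) semiring of the set \<open>E\<close> of edges of \<open>\<bbbH>\<^sub>n\<close>, where an edge
  is regarded as a commutative word, the product of its vertices. Its elements are the sets
  \<open>{m. m + L \<subseteq> E}\<close> of contexts that bring a nonempty set \<open>L\<close> of nonempty words into \<open>E\<close>; addition
  comes from union of word sets and multiplication from their elementwise product. Under the obvious
  assignment \<open>\<^bold>t\<close> becomes the residual of \<open>E\<close>, which contains the empty context. The residual of
  \<open>\<^bold>t + \<^bold>q\<close> does not, because the product of all vertices is not an edge: otherwise it would be the
  only edge and \<open>\<bbbH>\<^sub>n\<close> would be colourable.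

  That a fixed identity \<open>s \<approx> t\<close> of \<open>S\<^sub>c(a\<^sub>1\<cdots>a\<^sub>k)\<close> holds in the residual semiring of a \<open>k\<close>-uniform
  hypergraph of large girth is lemma \<open>residual_lang_subset\<close>. Only boundedly many edges are involved
  in a potential failure, so that they form a hyperforest \<open>F\<close>. Each colouring of \<open>F\<close> in which all
  edges are rainbow translates the situation into an assignment in \<open>S\<^sub>c(a\<^sub>1\<cdots>a\<^sub>k)\<close>, where the
  identity holds. It follows that some word, which has to be shown to be an edge, receives each of
  the \<open>k\<close> colours exactly once, in every rainbow colouring of \<open>F\<close>. For \<open>k \<ge> 3\<close> a hyperforest has so
  many rainbow colourings that only its edges have this property (lemma
  \<open>hyperedge_if_always_rainbow\<close>). For \<open>k = 2\<close> this fails: the two ends of a path with three edges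
  always have different colours.
\<close>

section \<open>Hyperforests\<close>

text \<open>
  The construction adds leaves: a new edge meets the union of the earlier ones in at most one vertex.
  In this form colourings extend edge by edge.
\<close>

inductive hyperforest :: "'v set set \<Rightarrow> bool" where
  empty: "hyperforest {}"
| insert: "hyperforest F \<Longrightarrow> card (e \<inter> \<Union>F) \<le> 1 \<Longrightarrow> hyperforest (insert e F)"

text \<open>
  If every edge shares two vertices with the others, one can walk forever from edge to edge, changing
  both the edge and the vertex in each step. A shortest stretch \<open>i, \<dots>, i + d\<close> of the walk at the
  ends of which the vertex or the edge is repeated closes up to a cycle of length \<open>d\<close>. Measuring
  vertex and edge repetitions by the same \<open>d\<close> ensures that both are distinct inside the stretch.
\<close>

lemma short_cycle_if_no_leaf:
  assumes F: "F \<subseteq> hyperedges H" "finite F" "F \<noteq> {}"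
    and verts: "\<And>e. e \<in> hyperedges H \<Longrightarrow> e \<noteq> {} \<and> e \<subseteq> verts H"
    and no_leaf: "\<And>e. e \<in> F \<Longrightarrow> \<not> card (e \<inter> \<Union>(F - {e})) \<le> 1"
  shows "\<exists>d v e. is_cycle H d v e \<and> d \<le> card F"
proof -
  have step: "\<exists>v' e'. e' \<in> F \<and> e' \<noteq> e \<and> v' \<noteq> v \<and> v' \<in> e \<and> v' \<in> e'" if "e \<in> F" for v e
  proof -
    have "\<exists>v'. v' \<in> e \<inter> \<Union>(F - {e}) \<and> v' \<noteq> v"
    proof (rule ccontr)
      assume "\<not> ?thesis"
      then have "e \<inter> \<Union>(F - {e}) \<subseteq> {v}" by blast
      then have "card (e \<inter> \<Union>(F - {e})) \<le> 1"
        using card_mono[of "{v}"] by fastforce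
      then show False using no_leaf[OF that] by simp
    qed
    then show ?thesis by blast
  qed
  obtain e0 where "e0 \<in> F" using F by blast
  then obtain v0 where "v0 \<in> e0" using verts F by blast
  define R where "R = (\<lambda>p q :: 'a \<times> 'a set. snd q \<noteq> snd p \<and> fst q \<noteq> fst p \<and> fst q \<in> snd p)"
  have "\<exists>f. \<forall>n. (snd (f n) \<in> F \<and> fst (f n) \<in> snd (f n)) \<and> R (f n) (f (Suc n))"
  proof (rule dependent_nat_choice)
    show "\<exists>p. snd p \<in> F \<and> fst p \<in> snd p"
      using \<open>e0 \<in> F\<close> \<open>v0 \<in> e0\<close> by (intro exI[of _ "(v0, e0)"]) simp
  next
    fix p :: "'a \<times> 'a set" and n :: nat
    assume "snd p \<in> F \<and> fst p \<in> snd p"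
    then obtain v' e' where "e' \<in> F" "e' \<noteq> snd p" "v' \<noteq> fst p" "v' \<in> snd p" "v' \<in> e'"
      using step by blast
    then show "\<exists>q. (snd q \<in> F \<and> fst q \<in> snd q) \<and> R p q"
      by (intro exI[of _ "(v', e')"]) (simp add: R_def)
  qed
  then obtain f where f: "\<And>n. snd (f n) \<in> F" "\<And>n. fst (f n) \<in> snd (f n)" "\<And>n. R (f n) (f (Suc n))"
    by blast
  \<comment> \<open>The walk enters \<open>e n\<close> at \<open>v n\<close> and leaves it at \<open>v (n + 1)\<close>.\<close>
  define v where "v n = fst (f n)" for n
  define e where "e n = snd (f n)" for n
  have walk: "e n \<in> F" "v n \<in> e n" "v (Suc n) \<in> e n" "v (Suc n) \<noteq> v n" "e (Suc n) \<noteq> e n" for n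
    using f by (auto simp: v_def e_def R_def)
  define D where "D d \<longleftrightarrow> d > 0 \<and> (\<exists>i. v i = v (i + d) \<or> e i = e (i + d))" for d
  have "\<not> inj e"
    using F walk(1) finite_subset[of "range e" F] range_inj_infinite[of e] by blast
  then obtain i j where "e i = e j" "i \<noteq> j" by (auto simp: inj_def)
  then have "\<exists>i j. e i = e j \<and> i < j" by (metis nat_neq_iff)
  then obtain i j where "e i = e j" "i < j" by blast
  then have "D (j - i)" unfolding D_def by (intro conjI exI[of _ i]) simp_all
  define d where "d = (LEAST d. D d)"
  have "D d" unfolding d_def using \<open>D (j - i)\<close> by (rule LeastI)
  have minimal: "\<not> D d'" if "d' < d" for d' using that not_less_Least unfolding d_def by blast
  have "\<not> D 1" using walk(4,5) unfolding D_def by (metis Suc_eq_plus1)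
  then have "d \<ge> 2" using \<open>D d\<close> by (cases "d = 1") (auto simp: D_def)
  have inj_v: "inj_on v {a..<a + d}" and inj_e: "inj_on e {a..<a + d}" for a
  proof -
    have "v x \<noteq> v y \<and> e x \<noteq> e y" if "x < y" "a \<le> x" "y < a + d" for x y
    proof -
      have "\<not> D (y - x)" using that by (intro minimal) linarith
      moreover have "x + (y - x) = y" using that by simp
      ultimately show ?thesis using that unfolding D_def by (metis zero_less_diff)
    qed
    then show "inj_on v {a..<a + d}" "inj_on e {a..<a + d}"
      by (auto simp: inj_on_def) (metis nat_neq_iff)+
  qed
  from \<open>D d\<close> obtain i where i: "v i = v (i + d) \<or> e i = e (i + d)" unfolding D_def by blast
  have in_verts: "v n \<in> verts H" for n using walk(1,2) F(1) verts by blast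
  have in_edges: "e n \<in> hyperedges H" for n using walk(1) F(1) by blast
  have "card (e ` {i..<i + d}) \<le> card F" using walk(1) F(2) by (intro card_mono) auto
  then have "d \<le> card F" using card_image[OF inj_e[of i]] by simp
  have "\<exists>v e. is_cycle H d v e"
  proof (cases "v i = v (i + d)")
    case True
    have "is_cycle H d (\<lambda>l. v (i + l)) (\<lambda>l. e (i + l - 1))"
      unfolding is_cycle_def
    proof (intro conjI)
      show "inj_on (\<lambda>l. v (i + l)) {0..<d}"
        using inj_v[of i] unfolding inj_on_def by force
      show "inj_on (\<lambda>l. e (i + l - 1)) {1..d}"
      proof (rule inj_onI)
        fix x y assume "x \<in> {1..d}" "y \<in> {1..d}" "e (i + x - 1) = e (i + y - 1)"
        then have "i + x - 1 = i + y - 1" by (intro inj_onD[OF inj_e[of i]]) auto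
        then show "x = y" using \<open>x \<in> {1..d}\<close> \<open>y \<in> {1..d}\<close> by auto
      qed
      show "\<forall>l\<in>{1..d}. {v (i + (l - 1)), v (i + l)} \<subseteq> e (i + l - 1)"
      proof
        fix l assume "l \<in> {1..d}"
        then show "{v (i + (l - 1)), v (i + l)} \<subseteq> e (i + l - 1)"
          using walk(2,3)[of "i + l - 1"] by (cases l) auto
      qed
    qed (use True \<open>d \<ge> 2\<close> in_verts in_edges in auto)
    then show ?thesis by blast
  next
    case False
    then have wrap: "e i = e (i + d)" using i by blast
    \<comment> \<open>Here the two ends \<open>e i\<close> and \<open>e (i + d)\<close> are one edge, left at \<open>v (i + 1)\<close> and entered again at
      \<open>v (i + d)\<close>. The cycle starts at \<open>v (i + 1)\<close> and uses this edge to return there.\<close>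
    define w where "w l = (if l < d then v (i + 1 + l) else v (i + 1))" for l
    have "is_cycle H d w (\<lambda>l. e (i + l))"
      unfolding is_cycle_def
    proof (intro conjI)
      show "inj_on w {0..<d}"
      proof (rule inj_onI)
        fix x y assume "x \<in> {0..<d}" "y \<in> {0..<d}" "w x = w y"
        then have "i + 1 + x = i + 1 + y"
          by (intro inj_onD[OF inj_v[of "i + 1"]]) (auto simp: w_def)
        then show "x = y" by simp
      qed
      show "inj_on (\<lambda>l. e (i + l)) {1..d}"
      proof (rule inj_onI)
        fix x y assume "x \<in> {1..d}" "y \<in> {1..d}" "e (i + x) = e (i + y)"
        then have "i + x = i + y"
          by (intro inj_onD[OF inj_e[of "i + 1"]]) auto
        then show "x = y" by simp
      qed
      show "\<forall>l\<in>{1..d}. {w (l - 1), w l} \<subseteq> e (i + l)"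
      proof
        fix l assume l: "l \<in> {1..d}"
        have "w (l - 1) = v (i + l)" using l by (cases l) (auto simp: w_def)
        moreover have "w l \<in> e (i + l)"
          using walk(3)[of "i + l"] walk(3)[of i] wrap l by (cases "l < d") (auto simp: w_def)
        ultimately show "{w (l - 1), w l} \<subseteq> e (i + l)" using walk(2) by simp
      qed
    qed (use \<open>d \<ge> 2\<close> in_verts in_edges in \<open>auto simp: w_def\<close>)
    then show ?thesis by blast
  qed
  then show ?thesis using \<open>d \<le> card F\<close> by blast
qed

lemma hyperforest_if_card_less_girth:
  assumes "finite F" "F \<subseteq> hyperedges H" "enat (card F) < girth H"
    and verts: "\<And>e. e \<in> hyperedges H \<Longrightarrow> e \<noteq> {} \<and> e \<subseteq> verts H"
  shows "hyperforest F"
  using assms(1-3)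
proof (induction "card F" arbitrary: F rule: less_induct)
  case less
  show ?case
  proof (cases "F = {}")
    case False
    have "\<exists>e\<in>F. card (e \<inter> \<Union>(F - {e})) \<le> 1"
    proof (rule ccontr)
      assume "\<not> ?thesis"
      then obtain d v e where "is_cycle H d v e" "d \<le> card F"
        using short_cycle_if_no_leaf[OF less.prems(2,1) False verts] by blast
      then have "girth H \<le> enat d" unfolding girth_def by (intro Inf_lower) auto
      then have "girth H \<le> enat (card F)" using \<open>d \<le> card F\<close> by (meson enat_ord_simps(1) order_trans)
      then show False using less.prems(3) by simp
    qed
    then obtain e where e: "e \<in> F" "card (e \<inter> \<Union>(F - {e})) \<le> 1" by blast
    have c: "card (F - {e}) < card F" using e(1) less.prems(1) by (meson card_Diff1_less)
    have "enat (card (F - {e})) < girth H"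
      using c less.prems(3) by (meson enat_ord_simps(2) less_trans)
    then have "hyperforest (F - {e})"
      using less.hyps[OF c] less.prems by blast
    then have "hyperforest (insert e (F - {e}))" using e(2) by (rule hyperforest.insert)
    then show ?thesis using e(1) by (simp add: insert_absorb)
  qed (simp add: hyperforest.empty)
qed

section \<open>Rainbow colourings of hyperforests\<close>

definition rainbow :: "nat \<Rightarrow> 'v set set \<Rightarrow> ('v \<Rightarrow> nat) \<Rightarrow> bool" where
  "rainbow k F \<kappa> \<longleftrightarrow> (\<forall>e\<in>F. bij_betw \<kappa> e {1..k})"

text \<open>
  A new leaf has at most one coloured vertex, so its remaining vertices can take the other colours in
  any order.
\<close>

lemma rainbow_extend:
  assumes "rainbow k F \<kappa>" "card (e \<inter> \<Union>F) \<le> 1" "card e = k" "k > 0"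
  obtains \<kappa>' where "rainbow k (insert e F) \<kappa>'" "\<And>v. v \<notin> e - \<Union>F \<Longrightarrow> \<kappa>' v = \<kappa> v"
proof -
  have fin: "finite e" using assms(3,4) card_ge_0_finite by blast
  let ?old = "e \<inter> \<Union>F" and ?new = "e - \<Union>F"
  have inj: "inj_on \<kappa> ?old"
  proof (cases "card ?old = 0")
    case False
    then have "card ?old = 1" using assms(2) by linarith
    then obtain p where "?old = {p}" using card_1_singletonE by blast
    then show ?thesis by simp
  qed (use fin in auto)
  have old: "\<kappa> ` ?old \<subseteq> {1..k}"
    using assms(1) unfolding rainbow_def bij_betw_def by blast
  have "card ?new = card ({1..k} - \<kappa> ` ?old)"
    using fin old assms(3) card_image[OF inj] card_Int_Diff[of e "\<Union>F"]
    by (simp add: card_Diff_subset)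
  then obtain g where g: "bij_betw g ?new ({1..k} - \<kappa> ` ?old)"
    using fin finite_same_card_bij[of ?new "{1..k} - \<kappa> ` ?old"] by blast
  define \<kappa>' where "\<kappa>' v = (if v \<in> ?new then g v else \<kappa> v)" for v
  have "bij_betw \<kappa>' ?new ({1..k} - \<kappa> ` ?old)"
    using g by (rule bij_betw_cong[THEN iffD1, rotated]) (simp add: \<kappa>'_def)
  moreover have "bij_betw \<kappa>' ?old (\<kappa> ` ?old)"
    using inj_on_imp_bij_betw[OF inj] by (rule bij_betw_cong[THEN iffD1, rotated]) (simp add: \<kappa>'_def)
  ultimately have "bij_betw \<kappa>' (?old \<union> ?new) (\<kappa> ` ?old \<union> ({1..k} - \<kappa> ` ?old))"
    by (intro bij_betw_combine) auto
  moreover have "?old \<union> ?new = e" "\<kappa> ` ?old \<union> ({1..k} - \<kappa> ` ?old) = {1..k}" using old by auto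
  ultimately have "bij_betw \<kappa>' e {1..k}" by simp
  moreover have "bij_betw \<kappa>' e' {1..k}" if "e' \<in> F" for e'
  proof -
    have "bij_betw \<kappa> e' {1..k}" using assms(1) that by (simp add: rainbow_def)
    then show ?thesis
      by (rule bij_betw_cong[THEN iffD1, rotated]) (use that in \<open>auto simp: \<kappa>'_def\<close>)
  qed
  ultimately have "rainbow k (insert e F) \<kappa>'" by (simp add: rainbow_def)
  then show thesis by (rule that) (auto simp: \<kappa>'_def)
qed

text \<open>Vertices in no other edge are interchangeable.\<close>

lemma rainbow_swap:
  assumes "rainbow k (insert e F) \<kappa>" "u \<in> e - \<Union>F" "z \<in> e - \<Union>F"
  shows "rainbow k (insert e F) (\<kappa> \<circ> transpose u z)"
proof -
  have "bij_betw (transpose u z) e e"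
    using assms by (intro permutes_imp_bij permutes_swap_id) auto
  then have "bij_betw (\<kappa> \<circ> transpose u z) e {1..k}"
    using assms(1) by (auto simp: rainbow_def intro: bij_betw_trans)
  moreover have "bij_betw (\<kappa> \<circ> transpose u z) e' {1..k}" if "e' \<in> F" for e'
  proof -
    have "bij_betw \<kappa> e' {1..k}" using assms(1) that by (simp add: rainbow_def)
    then show ?thesis
      by (rule bij_betw_cong[THEN iffD1, rotated])
        (use that assms in \<open>auto simp: transpose_def\<close>)
  qed
  ultimately show ?thesis by (simp add: rainbow_def)
qed

lemma rainbow_exists:
  assumes "hyperforest F" "\<forall>e\<in>F. card e = k" "k > 0"
  shows "\<exists>\<kappa>. rainbow k F \<kappa>"
  using assms
proof (induction rule: hyperforest.induct)
  case (insert F e)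
  then obtain \<kappa> where "rainbow k F \<kappa>" by auto
  then show ?case using rainbow_extend[of k F \<kappa> e] insert by (metis insertI1)
qed (auto simp: rainbow_def)

text \<open>
  If neither vertex is new in the last leaf \<open>e\<close>, a separating colouring of the rest extends to \<open>e\<close>.
  If \<open>y\<close> is new, only a vertex \<open>x \<notin> e\<close> can have its colour, and then \<open>y\<close> trades colours with another
  new vertex.
\<close>

lemma rainbow_separates:
  assumes "hyperforest F" "\<forall>e\<in>F. card e = k" "k \<ge> 3" "x \<noteq> y"
  shows "\<exists>\<kappa>. rainbow k F \<kappa> \<and> \<kappa> x \<noteq> \<kappa> y"
  using assms
proof (induction arbitrary: x y rule: hyperforest.induct)
  case empty
  then show ?case by (intro exI[of _ "\<lambda>v. if v = x then 0 else 1"]) (simp add: rainbow_def)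
next
  case (insert F e)
  have card_e: "card e = k" using insert.prems by simp
  then have fin: "finite e" using \<open>k \<ge> 3\<close> by (intro card_ge_0_finite) simp
  have new: "\<exists>\<kappa>. rainbow k (insert e F) \<kappa> \<and> \<kappa> x \<noteq> \<kappa> y" if y: "y \<in> e - \<Union>F" and "x \<noteq> y" for x y
  proof -
    have "hyperforest (insert e F)" using insert.hyps by (rule hyperforest.insert)
    then obtain \<kappa> where \<kappa>: "rainbow k (insert e F) \<kappa>"
      using rainbow_exists insert.prems by (metis gr0I not_numeral_le_zero)
    then have inj: "inj_on \<kappa> e" by (simp add: rainbow_def bij_betw_def)
    show ?thesis
    proof (cases "x \<in> e \<or> \<kappa> x \<noteq> \<kappa> y")
      case True
      then show ?thesis using \<kappa> inj that by (metis DiffD1 inj_onD)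
    next
      case False
      \<comment> \<open>This is where \<open>k \<ge> 3\<close> enters: \<open>e\<close> has at least two new vertices.\<close>
      have "card (e - \<Union>F) \<ge> 2"
        using card_Int_Diff[OF fin, of "\<Union>F"] insert.hyps(2) card_e \<open>k \<ge> 3\<close> by linarith
      then have "\<not> e - \<Union>F \<subseteq> {y}" using card_mono[of "{y}" "e - \<Union>F"] by auto
      then obtain z where z: "z \<in> e - \<Union>F" "z \<noteq> y" by blast
      have "(\<kappa> \<circ> transpose y z) x = \<kappa> x" using False z y by (auto simp: transpose_def)
      moreover have "(\<kappa> \<circ> transpose y z) y = \<kappa> z" by simp
      moreover have "\<kappa> z \<noteq> \<kappa> y" using inj z y by (auto dest: inj_onD)
      ultimately show ?thesis using rainbow_swap[OF \<kappa> y z(1)] False by metis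
    qed
  qed
  show ?case
  proof (cases "x \<in> e - \<Union>F \<or> y \<in> e - \<Union>F")
    case True
    then show ?thesis using new[of x y] new[of y x] \<open>x \<noteq> y\<close> by metis
  next
    case False
    obtain \<kappa> where "rainbow k F \<kappa>" "\<kappa> x \<noteq> \<kappa> y"
      using insert.IH insert.prems by (metis insertI2)
    then show ?thesis
      using rainbow_extend[of k F \<kappa> e] insert.hyps(2) card_e \<open>k \<ge> 3\<close> False
      by (metis gr0I not_numeral_le_zero)
  qed
qed

lemma inj_on_if_image_mset_eq_mset_set:
  assumes "image_mset f U = mset_set A"
  shows "inj_on f (set_mset U)"
proof (rule inj_onI, rule ccontr)
  fix x y assume "x \<in># U" "y \<in># U" "f x = f y" "x \<noteq> y"
  then obtain U' where "U = add_mset x (add_mset y U')"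
    by (metis insert_noteq_member mset_add)
  then have "count (mset_set A) (f x) \<ge> 2" using \<open>f x = f y\<close> assms[symmetric] by simp
  moreover have "count (mset_set A) (f x) \<le> 1" by (simp add: count_mset_set')
  ultimately show False by simp
qed

lemma eq_mset_set_if_image_mset_eq_mset_set:
  assumes "image_mset f U = mset_set A"
  shows "U = mset_set (set_mset U)"
proof -
  have "count U x = 1" if x: "x \<in># U" for x
  proof -
    obtain U' where U': "U = add_mset x U'" using mset_add[OF x] by blast
    have "x \<notin># U'"
    proof
      assume "x \<in># U'"
      then obtain U'' where "U' = add_mset x U''" by (rule mset_add)
      then have "U = add_mset x (add_mset x U'')" using U' by simp
      then have "count (mset_set A) (f x) \<ge> 2" using assms[symmetric] by simp
      moreover have "count (mset_set A) (f x) \<le> 1" by (simp add: count_mset_set')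
      ultimately show False by simp
    qed
    then show ?thesis using U' by (simp add: not_in_iff)
  qed
  then show ?thesis by (intro multiset_eqI) (auto simp: count_mset_set' not_in_iff)
qed

text \<open>
  Induction on the leaves. If \<open>U\<close> avoids the new vertices of the last leaf \<open>e\<close>, it is always rainbow on
  the smaller hyperforest, since colourings extend. If \<open>U\<close> contains a new vertex, it contains all of
  them, since otherwise swapping one inside with one outside would produce a repeated colour. So \<open>U\<close>
  is \<open>e\<close>, or it differs from \<open>e\<close> by having some \<open>y\<close> in place of the attaching vertex \<open>p\<close>. In the second
  case \<open>y\<close> and \<open>p\<close> have the same colour in all rainbow colourings, which contradicts
  \<open>rainbow_separates\<close>.
\<close>

lemma hyperedge_if_always_rainbow:
  assumes "hyperforest F" "\<forall>e\<in>F. card e = k" "k \<ge> 3"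
    and "\<And>\<kappa>. rainbow k F \<kappa> \<Longrightarrow> image_mset \<kappa> U = mset_set {1..k}"
  shows "U \<in> mset_set ` F"
  using assms
proof (induction rule: hyperforest.induct)
  case empty
  have "image_mset (\<lambda>_. 0) U = mset_set {1..k}" using empty.prems by (simp add: rainbow_def)
  then have "(\<lambda>_. 0 :: nat) ` set_mset U = {1..k}" by (metis finite_atLeastAtMost finite_set_mset_mset_set set_image_mset)
  then have "0 \<in> {1..k} \<or> {1..k} = {}" by auto
  then show ?case using \<open>k \<ge> 3\<close> by auto
next
  case (insert F e)
  let ?new = "e - \<Union>F"
  have k: "k > 0" using \<open>k \<ge> 3\<close> by simp
  have card_e: "card e = k" using insert.prems by simp
  then have fin: "finite e" using k card_ge_0_finite by blast
  have forest: "hyperforest (insert e F)" using insert.hyps by (rule hyperforest.insert)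
  have U: "inj_on \<kappa> (set_mset U)" "\<kappa> ` set_mset U = {1..k}" if "rainbow k (insert e F) \<kappa>" for \<kappa>
    using inj_on_if_image_mset_eq_mset_set[OF insert.prems(3)[OF that]]
      arg_cong[OF insert.prems(3)[OF that], of set_mset] by simp_all
  obtain \<kappa> where \<kappa>: "rainbow k (insert e F) \<kappa>"
    using rainbow_exists[OF forest insert.prems(1) k] by blast
  have card_U: "card (set_mset U) = k" using U[OF \<kappa>] card_image by fastforce
  have U_eq: "U = mset_set (set_mset U)"
    using eq_mset_set_if_image_mset_eq_mset_set[OF insert.prems(3)[OF \<kappa>]] .
  show ?case
  proof (cases "set_mset U \<inter> ?new = {}")
    case True
    have "image_mset \<kappa> U = mset_set {1..k}" if \<kappa>: "rainbow k F \<kappa>" for \<kappa>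
    proof -
      obtain \<kappa>' where \<kappa>': "rainbow k (insert e F) \<kappa>'" "\<And>v. v \<notin> ?new \<Longrightarrow> \<kappa>' v = \<kappa> v"
        using rainbow_extend[OF \<kappa> insert.hyps(2) card_e k] by blast
      have "image_mset \<kappa> U = image_mset \<kappa>' U"
        using True \<kappa>'(2) by (intro image_mset_cong) (metis disjoint_iff)
      then show ?thesis using insert.prems(3)[OF \<kappa>'(1)] by simp
    qed
    then show ?thesis using insert.IH insert.prems by auto
  next
    case False
    then obtain u where u: "u \<in># U" "u \<in> ?new" by blast
    have new: "?new \<subseteq> set_mset U"
    proof (rule ccontr)
      assume "\<not> ?thesis"
      then obtain z where z: "z \<in> ?new" "z \<notin># U" by blast
      have "\<kappa> z \<in> {1..k}" using \<kappa> z by (auto simp: rainbow_def bij_betw_def)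
      then obtain y where y: "y \<in># U" "\<kappa> y = \<kappa> z" using U(2)[OF \<kappa>] by (metis imageE)
      have "\<kappa> u \<noteq> \<kappa> z"
        using \<kappa> u z by (auto simp: rainbow_def bij_betw_def dest: inj_onD)
      then have "y \<noteq> u" "y \<noteq> z" using y z by auto
      then have "(\<kappa> \<circ> transpose u z) u = (\<kappa> \<circ> transpose u z) y" using y by simp
      then show False using U(1)[OF rainbow_swap[OF \<kappa> u(2) z(1)]] u(1) y(1) \<open>y \<noteq> u\<close>
        by (metis inj_onD)
    qed
    have "e \<subseteq> set_mset U"
    proof (rule ccontr)
      assume "\<not> ?thesis"
      then obtain p where p: "p \<in> e" "p \<notin># U" by blast
      then have "p \<in> e \<inter> \<Union>F" using new by blast
      then have old: "e \<inter> \<Union>F = {p}"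
        using insert.hyps(2) fin card_le_Suc0_iff_eq[of "e \<inter> \<Union>F"] by auto
      then have "?new = e - {p}" by blast
      then have "card (set_mset U - ?new) = 1"
        using card_Diff_subset[OF _ new] fin card_U card_e p(1) k by simp
      then obtain y where y: "set_mset U - ?new = {y}" using card_1_singletonE by blast
      then have "y \<noteq> p" using p by blast
      then obtain \<kappa> where \<kappa>: "rainbow k (insert e F) \<kappa>" "\<kappa> y \<noteq> \<kappa> p"
        using rainbow_separates[OF forest insert.prems(1) \<open>k \<ge> 3\<close>] by blast
      have "\<kappa> p \<in> {1..k}" using \<kappa> p by (auto simp: rainbow_def bij_betw_def)
      then obtain x where x: "x \<in># U" "\<kappa> x = \<kappa> p" using U(2)[OF \<kappa>(1)] by (metis imageE)
      have "inj_on \<kappa> e" using \<kappa>(1) by (simp add: rainbow_def bij_betw_def)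
      then have "x \<notin> e" using x p by (metis inj_onD)
      then have "x = y" using x(1) y by blast
      then show False using x(2) \<kappa>(2) by simp
    qed
    then have "e = set_mset U" using card_U card_e by (metis card_subset_eq finite_set_mset)
    then show ?thesis using U_eq by auto
  qed
qed

section \<open>Transport along isomorphisms\<close>

lemma eval_closed:
  assumes "ai_semiring A" "range \<sigma> \<subseteq> carrier A"
  shows "eval A \<sigma> t \<in> carrier A"
  using assms(2)
  by (induction t) (auto simp: ai_semiring.add_closed[OF assms(1)] ai_semiring.mul_closed[OF assms(1)])

lemma eval_hom:
  assumes "h \<in> ai_hom A B" "ai_semiring A" "range \<sigma> \<subseteq> carrier A"
  shows "eval B (h \<circ> \<sigma>) t = h (eval A \<sigma> t)"
proof (induction t)
  case (Var x)
  then show ?case by simp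
next
  case (Plus s t)
  have "h (x \<oplus>\<^bsub>A\<^esub> y) = h x \<oplus>\<^bsub>B\<^esub> h y" if "x \<in> carrier A" "y \<in> carrier A" for x y
    using assms(1) that by (simp add: ai_hom_def)
  then show ?case using Plus eval_closed[OF assms(2,3)] by simp
next
  case (Times s t)
  have "h (x \<otimes>\<^bsub>A\<^esub> y) = h x \<otimes>\<^bsub>B\<^esub> h y" if "x \<in> carrier A" "y \<in> carrier A" for x y
    using assms(1) that by (simp add: ai_hom_def)
  then show ?case using Times eval_closed[OF assms(2,3)] by simp
qed

lemma satisfies_if_embedding:
  assumes h: "h \<in> ai_hom A B" "inj_on h (carrier A)" and A: "ai_semiring A" and B: "satisfies B e"
  shows "satisfies A e"
  unfolding satisfies_def
proof (intro allI impI)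
  fix \<sigma> :: "'c \<Rightarrow> 'a" assume \<sigma>: "range \<sigma> \<subseteq> carrier A"
  then have "range (h \<circ> \<sigma>) \<subseteq> carrier B" using h(1) by (auto simp: ai_hom_def Pi_def)
  then have "eval B (h \<circ> \<sigma>) (fst e) = eval B (h \<circ> \<sigma>) (snd e)" using B unfolding satisfies_def by blast
  then have "h (eval A \<sigma> (fst e)) = h (eval A \<sigma> (snd e))" using eval_hom[OF h(1) A \<sigma>] by simp
  then show "eval A \<sigma> (fst e) = eval A \<sigma> (snd e)"
    using h(2) eval_closed[OF A \<sigma>] by (auto dest: inj_onD)
qed

lemma ai_iso_sym:
  assumes "ai_semiring A" "ai_iso A B"
  shows "ai_iso B A"
proof -
  interpret ai_semiring A by fact
  obtain h where h: "h \<in> ai_hom A B" "bij_betw h (carrier A) (carrier B)"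
    using assms(2) unfolding ai_iso_def by blast
  let ?g = "inv_into (carrier A) h"
  have g: "bij_betw ?g (carrier B) (carrier A)" using h(2) by (rule bij_betw_inv_into)
  have "?g x \<in> carrier A" "h (?g x) = x" if "x \<in> carrier B" for x
    using g h(2) that by (auto simp: bij_betw_def f_inv_into_f)
  moreover have "?g (h x) = x" if "x \<in> carrier A" for x
    using h(2) that by (simp add: bij_betw_inv_into_left)
  ultimately have "?g \<in> ai_hom B A"
    using h(1) add_closed mul_closed unfolding ai_hom_def by (auto simp: Pi_def) metis+
  then show ?thesis using g unfolding ai_iso_def by blast
qed

lemma ai_iso_trans:
  assumes "ai_iso A B" "ai_iso B C"
  shows "ai_iso A C"
proof -
  obtain h g where "h \<in> ai_hom A B" "bij_betw h (carrier A) (carrier B)"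
    "g \<in> ai_hom B C" "bij_betw g (carrier B) (carrier C)"
    using assms unfolding ai_iso_def by blast
  then have "g \<circ> h \<in> ai_hom A C" "bij_betw (g \<circ> h) (carrier A) (carrier C)"
    by (auto simp: ai_hom_def Pi_def intro: bij_betw_trans)
  then show ?thesis unfolding ai_iso_def by blast
qed

lemma satisfies_iff_if_ai_iso:
  assumes "ai_semiring A" "ai_semiring B" "ai_iso A B"
  shows "satisfies A e \<longleftrightarrow> satisfies B e"
  using assms ai_iso_sym[OF assms(1,3)] satisfies_if_embedding
  unfolding ai_iso_def bij_betw_def by metis

lemma ai_semiring_if_surj_hom:
  assumes A: "ai_semiring A" and h: "h \<in> ai_hom A B" "h ` carrier A = carrier B"
  shows "ai_semiring B"
proof -
  interpret ai_semiring A by fact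
  have hom: "h x \<oplus>\<^bsub>B\<^esub> h y = h (x \<oplus>\<^bsub>A\<^esub> y)" "h x \<otimes>\<^bsub>B\<^esub> h y = h (x \<otimes>\<^bsub>A\<^esub> y)"
    if "x \<in> carrier A" "y \<in> carrier A" for x y
    using h(1) that by (auto simp: ai_hom_def)
  show ?thesis
  proof
    show "carrier B \<noteq> {}" using h(2) carrier_nonempty by blast
  qed (auto simp: h(2)[symmetric] hom add_closed mul_closed add_idem add_assoc mul_assoc
      distrib_left distrib_right intro: arg_cong[of _ _ h, OF add_comm])
qed

lemma ex_isomorphic_copy:
  assumes "finite (carrier A)" "infinite (UNIV :: 'a set)" "ai_semiring A"
  shows "\<exists>B :: 'a ai_alg. ai_semiring B \<and> ai_iso A B"
proof -
  interpret ai_semiring A by fact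
  obtain X :: "'a set" where X: "finite X" "card X = card (carrier A)"
    using assms(2) infinite_arbitrarily_large by blast
  then obtain h where h: "bij_betw h (carrier A) X"
    using assms(1) finite_same_card_bij by metis
  define g where "g = inv_into (carrier A) h"
  have g: "g (h x) = x" if "x \<in> carrier A" for x
    using h that by (simp add: g_def bij_betw_inv_into_left)
  define B where "B = \<lparr>carrier = X, add = \<lambda>x y. h (g x \<oplus>\<^bsub>A\<^esub> g y), mul = \<lambda>x y. h (g x \<otimes>\<^bsub>A\<^esub> g y)\<rparr>"
  have "h \<in> ai_hom A B" using h by (auto simp: ai_hom_def B_def g bij_betw_def)
  moreover have bij: "bij_betw h (carrier A) (carrier B)" using h by (simp add: B_def)
  ultimately have "ai_semiring B" "ai_iso A B"
    using ai_semiring_if_surj_hom[OF assms(3), of h B] unfolding ai_iso_def bij_betw_def by blast+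
  then show ?thesis by blast
qed

text \<open>
  The varieties intersected in \<^const>\<open>generated_variety\<close> contain some copy of \<open>S\<close> each, not
  necessarily the same one. Closure under homomorphic images makes every copy a member of each.
\<close>

lemma mem_generated_variety_if_ai_iso:
  assumes "ai_semiring S" "ai_semiring T" "ai_iso S T"
  shows "(T :: 'b ai_alg) \<in> generated_variety S"
  unfolding generated_variety_def
proof (intro InterI, elim CollectE conjE bexE)
  fix \<D> and T' :: "'b ai_alg" assume \<D>: "variety \<D>" "T' \<in> \<D>" "ai_iso S T'"
  then have "ai_iso T' T" using assms ai_iso_sym ai_iso_trans by blast
  then obtain h where "h \<in> ai_hom T' T" "h ` carrier T' = carrier T"
    unfolding ai_iso_def bij_betw_def by blast
  then show "T \<in> \<D>" using \<D>(1,2) assms(2) unfolding variety_def by blast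
qed

section \<open>Terms as sets of commutative words\<close>

text \<open>
  These are the sets of commutative words over \<open>'v\<close> that may be substituted for variables. Both
  exclusions matter because the signature has no constants: the empty set would act as a zero of
  addition and the empty word as a unit of multiplication, and identities of a semiring without
  such elements may fail for them.
\<close>

definition word_sets :: "'v multiset set set" where
  "word_sets = {L. L \<noteq> {} \<and> {#} \<notin> L}"

primrec lang :: "('x \<Rightarrow> 'v multiset set) \<Rightarrow> 'x ai_term \<Rightarrow> 'v multiset set" where
  "lang L (Var x) = L x"
| "lang L (Plus s t) = lang L s \<union> lang L t"
| "lang L (Times s t) = lang L s + lang L t"

lemma word_sets_Un: "L \<in> word_sets \<Longrightarrow> K \<in> word_sets \<Longrightarrow> L \<union> K \<in> word_sets"
  by (auto simp: word_sets_def)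

lemma word_sets_plus: "L \<in> word_sets \<Longrightarrow> K \<in> word_sets \<Longrightarrow> L + K \<in> word_sets"
  by (auto simp: word_sets_def set_plus_def)

lemma lang_in_word_sets: "(\<And>x. L x \<in> word_sets) \<Longrightarrow> lang L t \<in> word_sets"
  by (induction t) (auto simp: word_sets_Un word_sets_plus)

lemma lang_mono: "(\<And>x. L x \<subseteq> K x) \<Longrightarrow> lang L t \<subseteq> lang K t"
  by (induction t) (auto intro: set_plus_mono2[THEN subsetD])

lemma image_mset_set_plus:
  "image_mset f ` (L + K) = image_mset f ` L + image_mset f ` K"
  unfolding set_plus_def by (auto simp: image_iff) (metis image_mset_union)+

lemma lang_image_mset: "lang (\<lambda>x. image_mset f ` L x) t = image_mset f ` lang L t"
  by (induction t) (auto simp: image_mset_set_plus image_Un)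

lemma card_set_plus_le:
  assumes "finite L" "finite K"
  shows "finite (L + K) \<and> card (L + K) \<le> card L * card K"
proof -
  have "L + K = (\<lambda>(u, v). u + v) ` (L \<times> K)" by (auto simp: set_plus_def)
  then show ?thesis
    using assms card_image_le[of "L \<times> K" "\<lambda>(u, v). u + v"] by (simp add: card_cartesian_product)
qed

text \<open>
  Because the bound is uniform in the substitution, the girth that makes an identity hold can be fixed
  before the hypergraph is chosen.
\<close>

lemma card_lang_bounded:
  fixes t :: "'x ai_term"
  shows "\<exists>b. \<forall>L :: 'x \<Rightarrow> 'v multiset set.
    (\<forall>x. finite (L x) \<and> card (L x) \<le> c) \<longrightarrow> finite (lang L t) \<and> card (lang L t) \<le> b"
proof (induction t)
  case (Var x)
  then show ?case by auto
next
  case (Plus s t)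
  obtain a where a: "\<forall>L :: 'x \<Rightarrow> 'v multiset set.
      (\<forall>x. finite (L x) \<and> card (L x) \<le> c) \<longrightarrow> finite (lang L s) \<and> card (lang L s) \<le> a"
    using Plus.IH(1) by (rule exE)
  obtain b where b: "\<forall>L :: 'x \<Rightarrow> 'v multiset set.
      (\<forall>x. finite (L x) \<and> card (L x) \<le> c) \<longrightarrow> finite (lang L t) \<and> card (lang L t) \<le> b"
    using Plus.IH(2) by (rule exE)
  show ?case
  proof (intro exI[of _ "a + b"] allI impI)
    fix L :: "'x \<Rightarrow> 'v multiset set" assume "\<forall>x. finite (L x) \<and> card (L x) \<le> c"
    then have L: "finite (lang L s) \<and> card (lang L s) \<le> a" "finite (lang L t) \<and> card (lang L t) \<le> b"
      using a b by simp_all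
    then have "card (lang L s \<union> lang L t) \<le> a + b"
      using card_Un_le[of "lang L s" "lang L t"] by linarith
    then show "finite (lang L (Plus s t)) \<and> card (lang L (Plus s t)) \<le> a + b" using L by simp
  qed
next
  case (Times s t)
  obtain a where a: "\<forall>L :: 'x \<Rightarrow> 'v multiset set.
      (\<forall>x. finite (L x) \<and> card (L x) \<le> c) \<longrightarrow> finite (lang L s) \<and> card (lang L s) \<le> a"
    using Times.IH(1) by (rule exE)
  obtain b where b: "\<forall>L :: 'x \<Rightarrow> 'v multiset set.
      (\<forall>x. finite (L x) \<and> card (L x) \<le> c) \<longrightarrow> finite (lang L t) \<and> card (lang L t) \<le> b"
    using Times.IH(2) by (rule exE)
  show ?case
  proof (intro exI[of _ "a * b"] allI impI)
    fix L :: "'x \<Rightarrow> 'v multiset set" assume "\<forall>x. finite (L x) \<and> card (L x) \<le> c"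
    then have L: "finite (lang L s) \<and> card (lang L s) \<le> a" "finite (lang L t) \<and> card (lang L t) \<le> b"
      using a b by simp_all
    then have "card (lang L s) * card (lang L t) \<le> a * b" by (intro mult_le_mono) auto
    then show "finite (lang L (Times s t)) \<and> card (lang L (Times s t)) \<le> a * b"
      using card_set_plus_le[of "lang L s" "lang L t"] L by simp
  qed
qed

text \<open>
  Each occurrence of a variable contributes a single word to \<open>w\<close>, so the number of words needed
  is at most the number of leaves of \<open>t\<close>.
\<close>

lemma mem_lang_finitary:
  assumes "w \<in> lang L t"
  shows "\<exists>K. (\<forall>x. K x \<subseteq> L x \<and> finite (K x) \<and> card (K x) \<le> Suc (size t)) \<and> w \<in> lang K t"
  using assms
proof (induction t arbitrary: w)
  case (Var x)
  then show ?case by (intro exI[of _ "\<lambda>y. if y = x then {w} else {}"]) auto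
next
  case (Plus s t)
  then consider "w \<in> lang L s" | "w \<in> lang L t" by auto
  then show ?case
  proof cases
    case 1
    then obtain K where "\<forall>x. K x \<subseteq> L x \<and> finite (K x) \<and> card (K x) \<le> Suc (size s)" "w \<in> lang K s"
      using Plus.IH(1) by blast
    then show ?thesis by (intro exI[of _ K]) (auto intro: order_trans)
  next
    case 2
    then obtain K where "\<forall>x. K x \<subseteq> L x \<and> finite (K x) \<and> card (K x) \<le> Suc (size t)" "w \<in> lang K t"
      using Plus.IH(2) by blast
    then show ?thesis by (intro exI[of _ K]) (auto intro: order_trans)
  qed
next
  case (Times s t)
  then obtain u v where w: "w = u + v" "u \<in> lang L s" "v \<in> lang L t" by (auto elim: set_plus_elim)
  obtain K where K: "\<forall>x. K x \<subseteq> L x \<and> finite (K x) \<and> card (K x) \<le> Suc (size s)" "u \<in> lang K s"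
    using Times.IH(1) w by blast
  obtain M where M: "\<forall>x. M x \<subseteq> L x \<and> finite (M x) \<and> card (M x) \<le> Suc (size t)" "v \<in> lang M t"
    using Times.IH(2) w by blast
  have "u \<in> lang (\<lambda>x. K x \<union> M x) s" "v \<in> lang (\<lambda>x. K x \<union> M x) t"
    using K(2) M(2) lang_mono[of K "\<lambda>x. K x \<union> M x"] lang_mono[of M "\<lambda>x. K x \<union> M x"] by auto
  then have "w \<in> lang (\<lambda>x. K x \<union> M x) (Times s t)" using w(1) by auto
  moreover have "card (K x \<union> M x) \<le> Suc (size (Times s t))" for x
  proof -
    have "card (K x \<union> M x) \<le> card (K x) + card (M x)" by (rule card_Un_le)
    also have "\<dots> \<le> Suc (size s) + Suc (size t)" using K(1) M(1) by (intro add_mono) auto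
    finally show ?thesis by simp
  qed
  ultimately show ?case using K(1) M(1) by (intro exI[of _ "\<lambda>x. K x \<union> M x"]) auto
qed

section \<open>Evaluation in the flat semiring of subwords\<close>

text \<open>
  A sum of words is nonzero in \<open>S\<^sub>c(a\<^sub>1\<cdots>a\<^sub>k)\<close> only if all summands are the same subword of
  \<open>a\<^sub>1\<cdots>a\<^sub>k\<close>. This value map is a homomorphism from nonempty sets of words, with union and
  elementwise product.
\<close>

definition S_c_value :: "nat \<Rightarrow> nat multiset set \<Rightarrow> nat multiset option" where
  "S_c_value k L = (if \<exists>u. L = {u} \<and> u \<subseteq># mset_set {1..k} then Some (the_elem L) else None)"

lemma S_c_value_eq_Some_iff:
  "S_c_value k L = Some u \<longleftrightarrow> L = {u} \<and> u \<subseteq># mset_set {1..k}"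
  by (auto simp: S_c_value_def)

lemma ai_semiring_S_c: "ai_semiring (S_c k)"
proof
  let ?X = "mset_set {1..k}"
  have sub: "u \<subseteq># ?X" "v \<subseteq># ?X" if "u + v \<subseteq># ?X" for u v
    using that by (meson mset_subset_eq_add_left mset_subset_eq_add_right subset_mset.order_trans)+
  fix x y z assume "x \<in> carrier (S_c k)" "y \<in> carrier (S_c k)" "z \<in> carrier (S_c k)"
  show "x \<otimes>\<^bsub>S_c k\<^esub> y \<otimes>\<^bsub>S_c k\<^esub> z = x \<otimes>\<^bsub>S_c k\<^esub> (y \<otimes>\<^bsub>S_c k\<^esub> z)"
    using sub(1)[of "the x + the y" "the z"] sub(2)[of "the x" "the y + the z"]
    by (auto simp: S_c_def add.assoc split: option.splits)
qed (auto simp: S_c_def split: option.splits)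

lemma finite_submultisets: "finite {u. u \<subseteq># M}"
proof (induction M)
  case (add x M)
  have "{u. u \<subseteq># add_mset x M} \<subseteq> {u. u \<subseteq># M} \<union> add_mset x ` {u. u \<subseteq># M}"
  proof
    fix u assume u: "u \<in> {u. u \<subseteq># add_mset x M}"
    show "u \<in> {u. u \<subseteq># M} \<union> add_mset x ` {u. u \<subseteq># M}"
    proof (cases "x \<in># u")
      case True
      then obtain u' where "u = add_mset x u'" by (rule mset_add)
      then show ?thesis using u by auto
    next
      case False
      then have "u \<subseteq># M"
        using u by (metis mem_Collect_eq diff_single_trivial subset_eq_diff_conv add_mset_add_single)
      then show ?thesis by blast
    qed
  qed
  then show ?case using add finite_subset by blast
qed simp

lemma finite_carrier_S_c: "finite (carrier (S_c k))"
proof -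
  have "carrier (S_c k) \<subseteq> insert None (Some ` {u. u \<subseteq># mset_set {1..k}})"
    by (auto simp: S_c_def)
  then show ?thesis using finite_submultisets finite_subset by blast
qed

lemma S_c_value_in_carrier: "L \<in> word_sets \<Longrightarrow> S_c_value k L \<in> carrier (S_c k)"
  by (auto simp: S_c_value_def S_c_def word_sets_def)

lemma S_c_value_Un:
  assumes "L \<noteq> {}" "K \<noteq> {}"
  shows "S_c_value k (L \<union> K) = S_c_value k L \<oplus>\<^bsub>S_c k\<^esub> S_c_value k K"
  using assms by (auto simp: S_c_value_def S_c_def Un_singleton_iff)

text \<open>
  Commutative words are cancellative, so a factor with two elements makes a product with two
  elements. This is why multiplication cannot turn the value \<open>0\<close> of a nonconstant sum into a word.
\<close>

lemma set_plus_eq_singleton_iff: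
  fixes L K :: "'v multiset set"
  assumes "L \<noteq> {}" "K \<noteq> {}"
  shows "L + K = {w} \<longleftrightarrow> (\<exists>u v. L = {u} \<and> K = {v} \<and> w = u + v)"
proof
  assume eq: "L + K = {w}"
  obtain u v where uv: "u \<in> L" "v \<in> K" using assms by blast
  have sum: "u' + v' = w" if "u' \<in> L" "v' \<in> K" for u' v'
    using eq set_plus_intro[OF that] by auto
  have "u' = u" if "u' \<in> L" for u'
    using sum[OF that uv(2)] sum[OF uv] by (metis add_right_cancel)
  moreover have "v' = v" if "v' \<in> K" for v'
    using sum[OF uv(1) that] sum[OF uv] by (metis add_left_cancel)
  ultimately show "\<exists>u v. L = {u} \<and> K = {v} \<and> w = u + v" using uv sum by blast
qed (auto simp: set_plus_def)

lemma S_c_value_plus: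
  assumes "L \<noteq> {}" "K \<noteq> {}"
  shows "S_c_value k (L + K) = S_c_value k L \<otimes>\<^bsub>S_c k\<^esub> S_c_value k K"
proof -
  let ?X = "mset_set {1..k}"
  have sub: "u \<subseteq># ?X" "v \<subseteq># ?X" if "u + v \<subseteq># ?X" for u v
    using that by (meson mset_subset_eq_add_left mset_subset_eq_add_right subset_mset.order_trans)+
  show ?thesis
  proof (cases "\<exists>u v. L = {u} \<and> K = {v}")
    case True
    then obtain u v where "L = {u}" "K = {v}" by blast
    moreover have "{u} + {v} = {u + v}" by (auto simp: set_plus_def)
    ultimately show ?thesis using sub[of u v] by (auto simp: S_c_value_def S_c_def)
  next
    case False
    then have "S_c_value k L = None \<or> S_c_value k K = None" by (auto simp: S_c_value_def)
    moreover have "S_c_value k (L + K) = None"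
      using False set_plus_eq_singleton_iff[OF assms] by (auto simp: S_c_value_def)
    ultimately show ?thesis by (auto simp: S_c_def split: option.splits)
  qed
qed

lemma eval_S_c:
  assumes "\<And>x. L x \<in> word_sets"
  shows "eval (S_c k) (\<lambda>x. S_c_value k (L x)) t = S_c_value k (lang L t)"
proof (induction t)
  case (Plus s t)
  then show ?case using S_c_value_Un lang_in_word_sets[of L] assms by (simp add: word_sets_def)
next
  case (Times s t)
  then show ?case using S_c_value_plus lang_in_word_sets[of L] assms by (simp add: word_sets_def)
qed simp

section \<open>The residual semiring of a set of commutative words\<close>

text \<open>
  This is the syntactic semiring of \<open>E\<close>: two sets of words are identified if the same contexts
  bring them into \<open>E\<close>, and each class is represented by its set of contexts. The empty word is a
  context although it is not in any of the word sets, and this is what makes \<open>E\<close> itself visible: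
  \<open>L \<subseteq> E\<close> holds iff \<open>{#}\<close> is in the residual of \<open>L\<close>.
\<close>

definition residual :: "'v multiset set \<Rightarrow> 'v multiset set \<Rightarrow> 'v multiset set" where
  "residual E L = {m. \<forall>l\<in>L. m + l \<in> E}"

definition generators :: "'v multiset set \<Rightarrow> 'v multiset set \<Rightarrow> 'v multiset set" where
  "generators E M = {l. l \<noteq> {#} \<and> (\<forall>m\<in>M. m + l \<in> E)}"

text \<open>
  The product has to be given by sets of contexts alone. Any word set with residual \<open>M\<close> may serve
  as a factor, and \<open>generators E M\<close> is the largest one.
\<close>

definition residual_semiring :: "'v multiset set \<Rightarrow> 'v multiset set ai_alg" where
  "residual_semiring E =
     \<lparr>carrier = residual E ` word_sets,
      add = (\<inter>),
      mul = (\<lambda>M N. residual E (generators E M + generators E N))\<rparr>"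

lemma residual_Un: "residual E L \<inter> residual E K = residual E (L \<union> K)"
  by (auto simp: residual_def)

text \<open>
  Closing a factor to the largest word set with the same residual does not change the residual of
  the product, because the other factor together with the context is again a context.
\<close>

lemma residual_mult:
  assumes "L \<in> word_sets" "K \<in> word_sets"
  shows "residual E (generators E (residual E L) + generators E (residual E K)) = residual E (L + K)"
    (is "?lhs = ?rhs")
proof
  have "L \<subseteq> generators E (residual E L)" "K \<subseteq> generators E (residual E K)"
    using assms by (auto simp: generators_def residual_def word_sets_def)
  then have "L + K \<subseteq> generators E (residual E L) + generators E (residual E K)"
    by (rule set_plus_mono2)
  then show "?lhs \<subseteq> ?rhs" by (auto simp: residual_def)
next
  show "?rhs \<subseteq> ?lhs"
  proof
    fix m assume m: "m \<in> ?rhs"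
    have "m + (l + k) \<in> E"
      if l: "l \<in> generators E (residual E L)" and k: "k \<in> generators E (residual E K)" for l k
    proof -
      have "m + l' \<in> residual E K" if "l' \<in> L" for l'
        using m that by (auto simp: residual_def add.assoc)
      then have "m + l' + k \<in> E" if "l' \<in> L" for l'
        using k that unfolding generators_def by blast
      then have "m + k \<in> residual E L" by (auto simp: residual_def ac_simps)
      then have "m + k + l \<in> E" using l unfolding generators_def by blast
      then show ?thesis by (simp add: ac_simps)
    qed
    then show "m \<in> ?lhs" by (auto simp: residual_def elim!: set_plus_elim)
  qed
qed

lemma residual_semiring_ops:
  assumes "L \<in> word_sets" "K \<in> word_sets"
  shows "residual E L \<oplus>\<^bsub>residual_semiring E\<^esub> residual E K = residual E (L \<union> K)"
    and "residual E L \<otimes>\<^bsub>residual_semiring E\<^esub> residual E K = residual E (L + K)"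
  using residual_mult[OF assms] by (simp_all add: residual_semiring_def residual_Un)

lemma ai_semiring_residual_semiring: "ai_semiring (residual_semiring E)"
proof
  let ?S = "residual_semiring E"
  have carrier: "carrier ?S = residual E ` word_sets" by (simp add: residual_semiring_def)
  have "{{#undefined#}} \<in> (word_sets :: 'a multiset set set)" by (simp add: word_sets_def)
  then show "carrier ?S \<noteq> {}" unfolding carrier by blast
  fix x y assume "x \<in> carrier ?S" "y \<in> carrier ?S"
  then obtain L K where xy: "x = residual E L" "y = residual E K"
    and LK: "L \<in> word_sets" "K \<in> word_sets"
    unfolding carrier by blast
  note ops = residual_semiring_ops word_sets_Un word_sets_plus LK
  show "x \<oplus>\<^bsub>?S\<^esub> y \<in> carrier ?S" "x \<otimes>\<^bsub>?S\<^esub> y \<in> carrier ?S"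
    unfolding xy carrier by (simp_all add: ops)
  show "x \<oplus>\<^bsub>?S\<^esub> y = y \<oplus>\<^bsub>?S\<^esub> x" "x \<oplus>\<^bsub>?S\<^esub> x = x"
    unfolding xy by (simp_all add: ops Un_commute)
  fix z assume "z \<in> carrier ?S"
  then obtain M where z: "z = residual E M" and M: "M \<in> word_sets" unfolding carrier by blast
  show "x \<oplus>\<^bsub>?S\<^esub> y \<oplus>\<^bsub>?S\<^esub> z = x \<oplus>\<^bsub>?S\<^esub> (y \<oplus>\<^bsub>?S\<^esub> z)"
    "x \<otimes>\<^bsub>?S\<^esub> y \<otimes>\<^bsub>?S\<^esub> z = x \<otimes>\<^bsub>?S\<^esub> (y \<otimes>\<^bsub>?S\<^esub> z)"
    "x \<otimes>\<^bsub>?S\<^esub> (y \<oplus>\<^bsub>?S\<^esub> z) = (x \<otimes>\<^bsub>?S\<^esub> y) \<oplus>\<^bsub>?S\<^esub> (x \<otimes>\<^bsub>?S\<^esub> z)"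
    "(x \<oplus>\<^bsub>?S\<^esub> y) \<otimes>\<^bsub>?S\<^esub> z = (x \<otimes>\<^bsub>?S\<^esub> z) \<oplus>\<^bsub>?S\<^esub> (y \<otimes>\<^bsub>?S\<^esub> z)"
    unfolding xy z by (simp_all add: ops M Un_assoc add.assoc Un_set_plus set_plus_Un)
qed

lemma finite_carrier_residual_semiring:
  assumes "finite E"
  shows "finite (carrier (residual_semiring E))"
proof -
  have "carrier (residual_semiring E) \<subseteq> Pow (\<Union>w\<in>E. {m. m \<subseteq># w})"
    by (force simp: residual_semiring_def residual_def word_sets_def)
  moreover have "finite (Pow (\<Union>w\<in>E. {m. m \<subseteq># w}))"
    using assms by (simp add: finite_submultisets)
  ultimately show ?thesis by (rule finite_subset)
qed

lemma eval_residual_semiring: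
  assumes "\<And>x. L x \<in> word_sets"
  shows "eval (residual_semiring E) (\<lambda>x. residual E (L x)) t = residual E (lang L t)"
proof (induction t)
  case (Plus s t)
  then show ?case by (simp add: residual_semiring_ops(1) lang_in_word_sets assms)
next
  case (Times s t)
  then show ?case by (simp add: residual_semiring_ops(2) lang_in_word_sets assms)
qed simp

section \<open>Transfer of identities\<close>

abbreviation edge_words :: "'v hypergraph \<Rightarrow> 'v multiset set" where
  "edge_words H \<equiv> mset_set ` hyperedges H"

text \<open>
  The heart of the proof. Let \<open>m\<close> be a context that brings all words of \<open>s\<close> into the set of edges,
  and let \<open>w\<close> be a word of \<open>t\<close>. Producing \<open>w\<close> takes only boundedly many of the words substituted for
  each variable. After discarding the others, \<open>s\<close> has boundedly many words, so the edges that they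
  complete to by \<open>m\<close> form a hyperforest \<open>F\<close>. A rainbow colouring of \<open>F\<close> turns the substitution into
  an assignment in \<open>S\<^sub>c(a\<^sub>1\<cdots>a\<^sub>k)\<close> under which \<open>s\<close> has a nonzero value, the complement of the colours
  of \<open>m\<close>. By the identity \<open>t\<close> has the same value, so \<open>m + w\<close> receives each colour once. As this holds
  for all rainbow colourings, \<open>m + w\<close> is an edge. The identity itself never has to be analysed.
\<close>

lemma residual_lang_subset:
  fixes H :: "'v hypergraph" and s t :: "'x ai_term"
  assumes s_t: "satisfies (S_c k) (s, t)" and "k \<ge> 3"
    and H: "finite_hypergraph H" "uniform k H"
    and bound: "\<And>K :: 'x \<Rightarrow> 'v multiset set. \<lbrakk>\<And>x. finite (K x) \<and> card (K x) \<le> Suc (Suc (size t))\<rbrakk>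
      \<Longrightarrow> finite (lang K s) \<and> enat (card (lang K s)) < girth H"
    and L: "\<And>x. L x \<in> word_sets"
  shows "residual (edge_words H) (lang L s) \<subseteq> residual (edge_words H) (lang L t)"
proof
  fix m assume m: "m \<in> residual (edge_words H) (lang L s)"
  have "m + w \<in> edge_words H" if w: "w \<in> lang L t" for w
  proof -
    obtain K' where K': "\<forall>x. K' x \<subseteq> L x \<and> finite (K' x) \<and> card (K' x) \<le> Suc (size t)" "w \<in> lang K' t"
      using mem_lang_finitary[OF w] by blast
    have "\<forall>x. \<exists>l. l \<in> L x" using L by (auto simp: word_sets_def)
    then obtain l where l: "\<And>x. l x \<in> L x" by metis
    \<comment> \<open>One extra word for each variable: \<open>K'\<close> may be empty at variables that \<open>w\<close> does not use, and
      an assignment needs nonempty sets.\<close>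
    define K where "K x = insert (l x) (K' x)" for x
    have K: "finite (K x) \<and> card (K x) \<le> Suc (Suc (size t))" for x
      using K'(1) card_insert_le_m1[of "Suc (Suc (size t))" "K' x" "l x"] by (simp add: K_def)
    have K_L: "K x \<subseteq> L x" for x using K'(1) l by (auto simp: K_def)
    have K_words: "K x \<in> word_sets" for x
      using K_L[of x] L[of x] by (auto simp: word_sets_def K_def)
    have w_K: "w \<in> lang K t" using K'(2) lang_mono[of K' K t] by (auto simp: K_def)
    define F where "F = (\<lambda>u. set_mset (m + u)) ` lang K s"
    have edge: "m + u \<in> edge_words H" if "u \<in> lang K s" for u
      using m that lang_mono[of K L s] K_L by (auto simp: residual_def)
    have fin_edge: "finite e" if "e \<in> hyperedges H" for e
      using H(1) that finite_subset unfolding finite_hypergraph_def by blast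
    have word_of_edge: "m + u = mset_set (set_mset (m + u)) \<and> set_mset (m + u) \<in> hyperedges H"
      if u: "u \<in> lang K s" for u
    proof -
      obtain e where "e \<in> hyperedges H" "m + u = mset_set e" using edge[OF u] by blast
      then show ?thesis using fin_edge by (metis finite_set_mset_mset_set)
    qed
    have F_H: "F \<subseteq> hyperedges H" using word_of_edge by (auto simp: F_def)
    have card_F: "\<forall>e\<in>F. card e = k" using F_H H(2) by (auto simp: uniform_def)
    have few: "finite (lang K s)" "enat (card (lang K s)) < girth H" using bound[of K] K by blast+
    then have "finite F" "card F \<le> card (lang K s)"
      unfolding F_def by (simp_all only: finite_imageI card_image_le)
    then have "enat (card F) < girth H"
      using few(2) by (meson enat_ord_simps(1) order_le_less_trans)
    then have "hyperforest F"
      using hyperforest_if_card_less_girth[of F H] \<open>finite F\<close> F_H H(1)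
      unfolding finite_hypergraph_def by blast
    moreover have "image_mset \<kappa> (m + w) = mset_set {1..k}" if \<kappa>: "rainbow k F \<kappa>" for \<kappa>
    proof -
      have rainbow_word: "image_mset \<kappa> (m + u) = mset_set {1..k}" if u: "u \<in> lang K s" for u
      proof -
        have "bij_betw \<kappa> (set_mset (m + u)) {1..k}"
          using \<kappa> u unfolding rainbow_def F_def by blast
        then have "image_mset \<kappa> (mset_set (set_mset (m + u))) = mset_set {1..k}"
          by (auto simp: bij_betw_def image_mset_mset_set simp del: set_mset_union)
        then show ?thesis using word_of_edge[OF u] by metis
      qed
      have complement: "image_mset \<kappa> u = mset_set {1..k} - image_mset \<kappa> m" if "u \<in> lang K s" for u
        using rainbow_word[OF that] by (metis add_diff_cancel_left' image_mset_union)
      have words: "image_mset \<kappa> ` K x \<in> word_sets" for x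
        using K_words[of x] by (auto simp: word_sets_def)
      obtain u where u: "u \<in> lang K s" using lang_in_word_sets[of K s] K_words by (auto simp: word_sets_def)
      have "range (\<lambda>x. S_c_value k (image_mset \<kappa> ` K x)) \<subseteq> carrier (S_c k)"
        using S_c_value_in_carrier[OF words] by blast
      then have "eval (S_c k) (\<lambda>x. S_c_value k (image_mset \<kappa> ` K x)) s
          = eval (S_c k) (\<lambda>x. S_c_value k (image_mset \<kappa> ` K x)) t"
        using s_t unfolding satisfies_def fst_conv snd_conv by blast
      then have "S_c_value k (image_mset \<kappa> ` lang K s) = S_c_value k (image_mset \<kappa> ` lang K t)"
        by (simp only: eval_S_c[OF words] lang_image_mset)
      moreover have "image_mset \<kappa> ` lang K s = {mset_set {1..k} - image_mset \<kappa> m}"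
        using complement u by force
      then have "S_c_value k (image_mset \<kappa> ` lang K s) = Some (mset_set {1..k} - image_mset \<kappa> m)"
        by (simp add: S_c_value_eq_Some_iff)
      ultimately have "image_mset \<kappa> ` lang K t = {mset_set {1..k} - image_mset \<kappa> m}"
        by (metis S_c_value_eq_Some_iff)
      then have "image_mset \<kappa> w = image_mset \<kappa> u" using w_K complement[OF u] by auto
      then show ?thesis using rainbow_word[OF u] by simp
    qed
    ultimately have "m + w \<in> mset_set ` F"
      using hyperedge_if_always_rainbow[of F k "m + w"] card_F \<open>k \<ge> 3\<close> by blast
    then show ?thesis using F_H by blast
  qed
  then show "m \<in> residual (edge_words H) (lang L t)" by (simp add: residual_def)
qed

lemma residual_semiring_satisfies:
  fixes e :: "'x identity"
  assumes "satisfies (S_c k) e" "k \<ge> 3"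
  shows "\<exists>b. \<forall>H :: 'v hypergraph. finite_hypergraph H \<and> uniform k H \<and> enat b < girth H
    \<longrightarrow> satisfies (residual_semiring (edge_words H)) e"
proof -
  obtain s t where e: "e = (s, t)" by fastforce
  obtain b where b: "\<And>K :: 'x \<Rightarrow> 'v multiset set. \<forall>x. finite (K x) \<and> card (K x) \<le> Suc (Suc (size t))
      \<Longrightarrow> finite (lang K s) \<and> card (lang K s) \<le> b"
    using card_lang_bounded[of "Suc (Suc (size t))" s] by blast
  obtain c where c: "\<And>K :: 'x \<Rightarrow> 'v multiset set. \<forall>x. finite (K x) \<and> card (K x) \<le> Suc (Suc (size s))
      \<Longrightarrow> finite (lang K t) \<and> card (lang K t) \<le> c"
    using card_lang_bounded[of "Suc (Suc (size s))" t] by blast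
  show ?thesis
  proof (intro exI[of _ "max b c"] allI impI)
    fix H :: "'v hypergraph"
    assume H: "finite_hypergraph H \<and> uniform k H \<and> enat (max b c) < girth H"
    let ?S = "residual_semiring (edge_words H)"
    have small: "enat n < girth H" if "n \<le> b \<or> n \<le> c" for n
    proof -
      have "enat n \<le> enat (max b c)" using that by auto
      then show ?thesis using H by (meson order_le_less_trans)
    qed
    have "residual (edge_words H) (lang L s) = residual (edge_words H) (lang L t)"
      if L: "\<And>x. L x \<in> word_sets" for L :: "'x \<Rightarrow> 'v multiset set"
    proof
      show "residual (edge_words H) (lang L s) \<subseteq> residual (edge_words H) (lang L t)"
        using assms H L b small by (intro residual_lang_subset[of k]) (auto simp: e)
      show "residual (edge_words H) (lang L t) \<subseteq> residual (edge_words H) (lang L s)"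
        using assms H L c small by (intro residual_lang_subset[of k]) (auto simp: e satisfies_def)
    qed
    then have eq: "eval ?S (\<lambda>x. residual (edge_words H) (L x)) s = eval ?S (\<lambda>x. residual (edge_words H) (L x)) t"
      if "\<And>x. L x \<in> word_sets" for L :: "'x \<Rightarrow> 'v multiset set"
      using that by (simp add: eval_residual_semiring)
    show "satisfies ?S e"
      unfolding satisfies_def
    proof (intro allI impI)
      fix \<sigma> :: "'x \<Rightarrow> 'v multiset set" assume "range \<sigma> \<subseteq> carrier ?S"
      then have "\<forall>x. \<exists>L. L \<in> word_sets \<and> \<sigma> x = residual (edge_words H) L"
        by (auto simp: residual_semiring_def image_subset_iff image_iff)
      then obtain L where L: "\<And>x. L x \<in> word_sets" "\<And>x. \<sigma> x = residual (edge_words H) (L x)" by metis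
      then have "\<sigma> = (\<lambda>x. residual (edge_words H) (L x))" by blast
      then show "eval ?S \<sigma> (fst e) = eval ?S \<sigma> (snd e)" using eq[OF L(1)] by (simp add: e)
    qed
  qed
qed

section \<open>Failure of the hypergraph identities\<close>

text \<open>
  Each variable is sent to the one-letter word of its vertex. The words of \<open>\<^bold>t\<close> are then exactly the
  edges, while \<open>\<^bold>q\<close> is the word of all vertices, which is not an edge.
\<close>

lemma lang_sum: "ts \<noteq> [] \<Longrightarrow> lang L (fold1 Plus ts) = (\<Union>t\<in>set ts. lang L t)"
  by (induction ts rule: induct_list012) auto

lemma lang_word:
  "xs \<noteq> [] \<Longrightarrow> lang (\<lambda>x. {{#x#}}) (word xs) = {mset xs}"
  unfolding word_def by (induction xs rule: induct_list012) (auto simp: set_plus_def)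

lemma lang_sum_of_words:
  assumes "finite X" "X \<noteq> {}" "[] \<notin> X"
  shows "lang (\<lambda>x. {{#x#}}) (sum_of_words X) = mset ` X"
proof -
  define xss where "xss = (SOME xss. distinct xss \<and> set xss = X)"
  have xss: "distinct xss \<and> set xss = X"
    unfolding xss_def by (rule someI_ex) (use finite_distinct_list[OF assms(1)] in blast)
  have "lang (\<lambda>x. {{#x#}}) (fold1 Plus (map word xss)) = (\<Union>xs\<in>X. lang (\<lambda>x. {{#x#}}) (word xs))"
    using xss assms(2) by (subst lang_sum) auto
  also have "\<dots> = (\<Union>xs\<in>X. {mset xs})" 
  proof (rule SUP_cong)
    fix xs assume "xs \<in> X"
    then show "lang (\<lambda>x. {{#x#}}) (word xs) = {mset xs}" using assms(3) by (intro lang_word) auto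
  qed simp
  also have "\<dots> = mset ` X" by auto
  finally show ?thesis unfolding sum_of_words_def xss_def .
qed

lemma lang_t_term:
  assumes "finite_hypergraph H" "hyperedges H \<noteq> {}"
  shows "lang (\<lambda>x. {{#x#}}) (t_term H) = edge_words H"
proof -
  let ?X = "{xs. distinct xs \<and> set xs \<in> hyperedges H}"
  have fin: "finite e" if "e \<in> hyperedges H" for e
    using assms(1) that finite_subset unfolding finite_hypergraph_def by blast
  have "?X \<subseteq> {xs. distinct xs \<and> set xs \<subseteq> verts H}"
    using assms(1) by (auto simp: finite_hypergraph_def)
  moreover have "finite {xs. distinct xs \<and> set xs \<subseteq> verts H}"
    using assms(1) finite_subset_distinct[of "verts H"] by (simp add: finite_hypergraph_def conj_commute)
  ultimately have "finite ?X" by (rule finite_subset)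
  have list: "\<exists>xs\<in>?X. mset xs = mset_set e" if "e \<in> hyperedges H" for e
    using finite_distinct_list[OF fin[OF that]] that by (metis (mono_tags) mem_Collect_eq mset_set_set)
  then have "?X \<noteq> {}" using assms(2) by blast
  have "[] \<notin> ?X" using assms(1) by (auto simp: finite_hypergraph_def)
  have "mset ` ?X = edge_words H"
    using list by (force simp: mset_set_set[symmetric])
  then show ?thesis
    using lang_sum_of_words[OF \<open>finite ?X\<close> \<open>?X \<noteq> {}\<close> \<open>[] \<notin> ?X\<close>] unfolding t_term_def by simp
qed

text \<open>
  If the whole vertex set is an edge, it is the only one by uniformity, and giving one vertex a
  colour of its own is a proper colouring.
\<close>

lemma not_colourable_imp:
  assumes "finite_hypergraph H" "uniform k H" "k \<ge> 2" "m \<ge> 2" "\<not> colourable m H"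
  shows "hyperedges H \<noteq> {}" and "verts H \<notin> hyperedges H"
proof -
  show "hyperedges H \<noteq> {}"
  proof
    assume "hyperedges H = {}"
    then have "colourable m H" unfolding colourable_def
      using \<open>m \<ge> 2\<close> by (intro exI[of _ "\<lambda>_. 1"]) auto
    then show False using assms(5) by simp
  qed
  show "verts H \<notin> hyperedges H"
  proof
    assume V: "verts H \<in> hyperedges H"
    have only: "e = verts H" if "e \<in> hyperedges H" for e
      using that V assms(1,2) card_subset_eq unfolding finite_hypergraph_def uniform_def by metis
    have "card (verts H) \<ge> 2" using V assms(2,3) by (simp add: uniform_def)
    then obtain x y where xy: "x \<in> verts H" "y \<in> verts H" "x \<noteq> y"
      by (metis card_2_iff' card_le_Suc0_iff_eq card_ge_0_finite not_less_eq_eq numeral_2_eq_2 Suc_le_eq zero_less_Suc order_less_le_trans)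
    let ?\<phi> = "\<lambda>v. if v = x then 1 else 2 :: nat"
    have "?\<phi> ` verts H = {1, 2}" using xy by auto
    then have "colourable m H" unfolding colourable_def
      using only \<open>m \<ge> 2\<close> by (intro exI[of _ ?\<phi>]) auto
    then show False using assms(5) by simp
  qed
qed

text \<open>
  The empty context separates the two sides: it is in the residual of the set of edges, and it would
  be in the residual of the right-hand side only if the product of all vertices were an edge.
\<close>

lemma residual_semiring_violates:
  assumes "finite_hypergraph H" "hyperedges H \<noteq> {}" "verts H \<notin> hyperedges H"
    and xs: "distinct xs" "set xs = verts H"
  shows "\<not> satisfies (residual_semiring (edge_words H)) (t_term H, Plus (t_term H) (word xs))"
proof
  let ?S = "residual_semiring (edge_words H)" and ?L = "\<lambda>x :: 'a. {{#x#}}"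
  assume sat: "satisfies ?S (t_term H, Plus (t_term H) (word xs))"
  have words: "?L x \<in> word_sets" for x by (simp add: word_sets_def)
  have "range (\<lambda>x. residual (edge_words H) (?L x)) \<subseteq> carrier ?S"
    using words by (auto simp: residual_semiring_def)
  then have "residual (edge_words H) (lang ?L (t_term H))
      = residual (edge_words H) (lang ?L (Plus (t_term H) (word xs)))"
    using sat eval_residual_semiring[of ?L "edge_words H", OF words] unfolding satisfies_def
    by (metis fst_conv snd_conv)
  moreover have "{#} \<in> residual (edge_words H) (lang ?L (t_term H))"
    using lang_t_term[OF assms(1,2)] by (simp add: residual_def)
  moreover have "xs \<noteq> []" using assms(1,2) xs(2) by (force simp: finite_hypergraph_def)
  then have "mset xs \<in> lang ?L (Plus (t_term H) (word xs))" by (simp add: lang_word)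
  ultimately have "mset xs \<in> edge_words H" by (force simp: residual_def)
  then obtain e where e: "e \<in> hyperedges H" "mset xs = mset_set e" by blast
  moreover have "finite e"
    using assms(1) e(1) finite_subset unfolding finite_hypergraph_def by blast
  ultimately have "e = verts H" using xs(2) by (metis finite_set_mset_mset_set set_mset_mset)
  then show False using e(1) assms(3) by simp
qed

section \<open>The interval contains no finitely based variety\<close>

theorem theorem4p1:
  fixes k m :: nat
    and H :: "nat \<Rightarrow> 'v hypergraph"
    and vs :: "nat \<Rightarrow> 'v list"
    and \<C> :: "'a ai_alg set"
  assumes "infinite (UNIV :: 'a set)"
    and "k \<ge> 3" and "m \<ge> 3"
    and "\<And>n. n \<ge> 3 \<Longrightarrow> finite_hypergraph (H n)"
    and "\<And>n. n \<ge> 3 \<Longrightarrow> uniform k (H n)"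
    and "\<And>n. n \<ge> 3 \<Longrightarrow> no_isolated_vertices (H n)"
    and "\<And>n. n \<ge> 3 \<Longrightarrow> girth (H n) > enat (k * ((k * n) choose 2))"
    and "\<And>n. n \<ge> 3 \<Longrightarrow> \<not> colourable m (H n)"
    and "\<And>n. n \<ge> 3 \<Longrightarrow> distinct (vs n) \<and> set (vs n) = verts (H n)"
    and "\<C> \<in> variety_interval (generated_variety (S_c k)) (W H vs)"
  shows "\<not> finitely_based \<C>"
proof
  assume "finitely_based \<C>"
  then obtain \<Sigma> :: "nat identity set" where \<Sigma>: "finite \<Sigma>" "\<C> = models \<Sigma>"
    unfolding finitely_based_def by blast
  obtain T :: "'a ai_alg" where T: "ai_semiring T" "ai_iso (S_c k) T"
    using ex_isomorphic_copy[OF finite_carrier_S_c assms(1) ai_semiring_S_c] by blast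
  have "T \<in> generated_variety (S_c k)"
    using mem_generated_variety_if_ai_iso[OF ai_semiring_S_c T] .
  then have "T \<in> models \<Sigma>" using assms(10) \<Sigma>(2) by (auto simp: variety_interval_def)
  then have S_c_\<Sigma>: "satisfies (S_c k) e" if "e \<in> \<Sigma>" for e
    using that satisfies_iff_if_ai_iso[OF ai_semiring_S_c T, of e] by (simp add: models_def)
  have "\<forall>e\<in>\<Sigma>. \<exists>b. \<forall>G :: 'v hypergraph. finite_hypergraph G \<and> uniform k G \<and> enat b < girth G
      \<longrightarrow> satisfies (residual_semiring (edge_words G)) e"
    using residual_semiring_satisfies[OF S_c_\<Sigma> \<open>k \<ge> 3\<close>] by blast
  then obtain b where b: "\<And>e G. \<lbrakk>e \<in> \<Sigma>; finite_hypergraph G; uniform k G; enat (b e) < girth G\<rbrakk>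
      \<Longrightarrow> satisfies (residual_semiring (edge_words (G :: 'v hypergraph))) e"
    by metis
  \<comment> \<open>The girth of \<open>H n\<close> is more than \<open>n\<close>, so this \<open>n\<close> serves all identities of \<open>\<Sigma>\<close> at once.\<close>
  define n where "n = 3 + (\<Sum>e\<in>\<Sigma>. b e)"
  then have n: "n \<ge> 3" by simp
  note H = assms(4)[OF n] assms(5)[OF n]
  have b_girth: "enat (b e) < girth (H n)" if "e \<in> \<Sigma>" for e
  proof -
    have "b e \<le> n" using member_le_sum[OF that, of b] \<Sigma>(1) by (simp add: n_def)
    also have "n \<le> k * n - 1" using \<open>k \<ge> 3\<close> n mult_le_mono1[of 3 k n] by linarith
    also have "\<dots> \<le> (k * n) choose 2"
    proof -
      obtain j where "k * n = Suc j" using \<open>k \<ge> 3\<close> n by (cases "k * n") auto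
      then show ?thesis by (simp add: numeral_2_eq_2)
    qed
    also have "\<dots> \<le> k * ((k * n) choose 2)" using \<open>k \<ge> 3\<close> by simp
    finally show ?thesis using assms(7)[OF n] by (meson enat_ord_simps(1) order_le_less_trans)
  qed
  let ?A = "residual_semiring (edge_words (H n))"
  have edges: "hyperedges (H n) \<noteq> {}" "verts (H n) \<notin> hyperedges (H n)"
    using not_colourable_imp[OF H _ _ assms(8)[OF n]] \<open>k \<ge> 3\<close> \<open>m \<ge> 3\<close> by simp_all
  have "finite (hyperedges (H n))"
    using H(1) finite_subset[of "hyperedges (H n)" "Pow (verts (H n))"]
    by (auto simp: finite_hypergraph_def)
  then obtain B :: "'a ai_alg" where B: "ai_semiring B" "ai_iso ?A B"
    using ex_isomorphic_copy[OF finite_carrier_residual_semiring assms(1) ai_semiring_residual_semiring]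
    by blast
  note A_iff_B = satisfies_iff_if_ai_iso[OF ai_semiring_residual_semiring B]
  have "satisfies B e" if "e \<in> \<Sigma>" for e using b[OF that H b_girth[OF that]] by (simp add: A_iff_B)
  then have "B \<in> \<C>" using B(1) \<Sigma>(2) by (simp add: models_def)
  then have "B \<in> W H vs" using assms(10) by (auto simp: variety_interval_def)
  then have "satisfies B (t_term (H n), Plus (t_term (H n)) (word (vs n)))"
    using n unfolding W_def models_def W_identities_def by blast
  then show False
    using residual_semiring_violates[OF H(1) edges] assms(9)[OF n] by (simp add: A_iff_B)
qed

end
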